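(* Let $\nabla$ be a torsion-free affine connection on a manifold of dimension $n\ge2$. If $\nabla$ is projectively equivalent to the Levi-Civita connection $\widehat\nabla$ of some Einstein metric, via the 1-form $\Upsilon_i$ (that is, $\widehat\nabla_au_b=\nabla_au_b-\Upsilon_au_b-\Upsilon_bu_a$ for all 1-forms $u$), then $$C_{kij}+W_{ij}{}^l{}_k\Upsilon_l=0,$$ where $C$ and $W$ are the projective Cotton tensor and projective Weyl tensor of $\nabla$.
   Context: Metrics are pseudo-Riemannian of any signature; $g$ is Einstein if its Ricci tensor is a constant multiple of $g$. Curvature: $(\nabla_a\nabla_b-\nabla_b\nabla_a)v^c=R_{ab}{}^c{}_dv^d$, $\mathrm{Ric}_{ab}=R_{ca}{}^c{}_b$. There is a unique decomposition $R_{ab}{}^c{}_d=W_{ab}{}^c{}_d+2\delta^c_{[a}P_{b]d}+\beta_{ab}\delta^c_d$ with $W$ (projective Weyl tensor) completely trace-free and $\beta_{ab}=-2P_{[ab]}$; $P$ is the projective Schouten tensor, $(n-1)P_{ab}=\mathrm{Ric}_{ab}+\beta_{ab}$. The projective Cotton tensor is $C_{dab}:=2\nabla_{[a}P_{b]d}=\nabla_aP_{bd}-\nabla_bP_{ad}$. *)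

theory Defs
  imports "HOL-Analysis.Analysis"
begin

section \<open>Smooth functions of \<open>n\<close> real variables\<close>

definition partial :: "'n::finite \<Rightarrow> (real^'n \<Rightarrow> real) \<Rightarrow> real^'n \<Rightarrow> real" where
  "partial i f p = frechet_derivative f (at p) (axis i 1)"

text \<open>\<open>Ck_on k S f\<close> is only used for open \<open>S\<close>.\<close>

fun Ck_on :: "nat \<Rightarrow> (real^'n::finite) set \<Rightarrow> (real^'n \<Rightarrow> real) \<Rightarrow> bool" where
  "Ck_on 0 S f = continuous_on S f"
| "Ck_on (Suc k) S f = (f differentiable_on S \<and> (\<forall>i. Ck_on k S (partial i f)))"

definition smooth_on :: "(real^'n::finite) set \<Rightarrow> (real^'n \<Rightarrow> real) \<Rightarrow> bool" where
  "smooth_on S f \<longleftrightarrow> (\<forall>k. Ck_on k S f)"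

section \<open>Smooth manifolds\<close>

text \<open>A chart is a coordinate domain together with its coordinate map; the dimension of the
  manifold is \<open>CARD('n)\<close>. The atlas need not be maximal.\<close>

type_synonym ('a, 'n) chart = "'a set \<times> ('a \<Rightarrow> real^'n)"

abbreviation coord_range :: "('a, 'n::finite) chart \<Rightarrow> (real^'n) set" where
  "coord_range \<kappa> \<equiv> snd \<kappa> ` fst \<kappa>"

definition overlap :: "('a, 'n::finite) chart \<Rightarrow> ('a, 'n) chart \<Rightarrow> (real^'n) set" where
  "overlap \<kappa> \<kappa>' = snd \<kappa> ` (fst \<kappa> \<inter> fst \<kappa>')"

definition transition :: "('a, 'n::finite) chart \<Rightarrow> ('a, 'n) chart \<Rightarrow> real^'n \<Rightarrow> real^'n" where
  "transition \<kappa> \<kappa>' = snd \<kappa>' \<circ> inv_into (fst \<kappa>) (snd \<kappa>)"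

definition smooth_manifold :: "'a topology \<Rightarrow> ('a, 'n::finite) chart set \<Rightarrow> bool" where
  "smooth_manifold M A \<longleftrightarrow>
     Hausdorff_space M \<and> second_countable M \<and>
     (\<Union>\<kappa>\<in>A. fst \<kappa>) = topspace M \<and>
     (\<forall>\<kappa>\<in>A. openin M (fst \<kappa>) \<and> open (coord_range \<kappa>) \<and>
        homeomorphic_map (subtopology M (fst \<kappa>)) (top_of_set (coord_range \<kappa>)) (snd \<kappa>)) \<and>
     (\<forall>\<kappa>\<in>A. \<forall>\<kappa>'\<in>A. \<forall>i. smooth_on (overlap \<kappa> \<kappa>') (\<lambda>q. transition \<kappa> \<kappa>' q $ i))"

text \<open>\<open>jac \<kappa> \<kappa>' i a\<close> is the partial derivative of the \<open>i\<close>-th coordinate of \<open>\<kappa>'\<close> with respect to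
  the \<open>a\<close>-th coordinate of \<open>\<kappa>\<close>, as a function of the coordinates of \<open>\<kappa>\<close>.\<close>

definition jac ::
  "('a, 'n::finite) chart \<Rightarrow> ('a, 'n) chart \<Rightarrow> 'n \<Rightarrow> 'n \<Rightarrow> real^'n \<Rightarrow> real" where
  "jac \<kappa> \<kappa>' i a = partial a (\<lambda>q. transition \<kappa> \<kappa>' q $ i)"

section \<open>Tensor fields and connections\<close>

text \<open>Geometric objects on the manifold are given by their components in every chart of the atlas,
  subject to the transformation law. Components are functions of the coordinates and are
  meaningful only on the coordinate range. The component \<open>\<Gamma> c a b\<close> of a connection is the
  Christoffel symbol with upper index \<open>c\<close> and with \<open>a\<close> the index of the direction of
  differentiation.\<close>

type_synonym 'n tensor1 = "'n \<Rightarrow> real^'n \<Rightarrow> real"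
type_synonym 'n tensor2 = "'n \<Rightarrow> 'n \<Rightarrow> real^'n \<Rightarrow> real"
type_synonym 'n connection = "'n \<Rightarrow> 'n \<Rightarrow> 'n \<Rightarrow> real^'n \<Rightarrow> real"

definition one_form ::
  "('a, 'n::finite) chart set \<Rightarrow> (('a, 'n) chart \<Rightarrow> 'n tensor1) \<Rightarrow> bool" where
  "one_form A u \<longleftrightarrow>
     (\<forall>\<kappa>\<in>A. \<forall>a. smooth_on (coord_range \<kappa>) (u \<kappa> a)) \<and>
     (\<forall>\<kappa>\<in>A. \<forall>\<kappa>'\<in>A. \<forall>q\<in>overlap \<kappa> \<kappa>'. \<forall>a.
        u \<kappa> a q = (\<Sum>i\<in>UNIV. jac \<kappa> \<kappa>' i a q * u \<kappa>' i (transition \<kappa> \<kappa>' q)))"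

definition pseudo_riemannian_metric ::
  "('a, 'n::finite) chart set \<Rightarrow> (('a, 'n) chart \<Rightarrow> 'n tensor2) \<Rightarrow> bool" where
  "pseudo_riemannian_metric A g \<longleftrightarrow>
     (\<forall>\<kappa>\<in>A. \<forall>a b. smooth_on (coord_range \<kappa>) (g \<kappa> a b)) \<and>
     (\<forall>\<kappa>\<in>A. \<forall>q\<in>coord_range \<kappa>.
        (\<forall>a b. g \<kappa> a b q = g \<kappa> b a q) \<and> invertible (\<chi> a b. g \<kappa> a b q)) \<and>
     (\<forall>\<kappa>\<in>A. \<forall>\<kappa>'\<in>A. \<forall>q\<in>overlap \<kappa> \<kappa>'. \<forall>a b.
        g \<kappa> a b q = (\<Sum>i\<in>UNIV. \<Sum>j\<in>UNIV.
          jac \<kappa> \<kappa>' i a q * jac \<kappa> \<kappa>' j b q * g \<kappa>' i j (transition \<kappa> \<kappa>' q)))"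

definition affine_connection ::
  "('a, 'n::finite) chart set \<Rightarrow> (('a, 'n) chart \<Rightarrow> 'n connection) \<Rightarrow> bool" where
  "affine_connection A \<Gamma> \<longleftrightarrow>
     (\<forall>\<kappa>\<in>A. \<forall>c a b. smooth_on (coord_range \<kappa>) (\<Gamma> \<kappa> c a b)) \<and>
     (\<forall>\<kappa>\<in>A. \<forall>\<kappa>'\<in>A. \<forall>q\<in>overlap \<kappa> \<kappa>'. \<forall>k a b.
        (\<Sum>c\<in>UNIV. jac \<kappa> \<kappa>' k c q * \<Gamma> \<kappa> c a b q) =
        (\<Sum>i\<in>UNIV. \<Sum>j\<in>UNIV.
          jac \<kappa> \<kappa>' i a q * jac \<kappa> \<kappa>' j b q * \<Gamma> \<kappa>' k i j (transition \<kappa> \<kappa>' q)) +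
        partial a (jac \<kappa> \<kappa>' k b) q)"

definition torsion_free ::
  "('a, 'n::finite) chart set \<Rightarrow> (('a, 'n) chart \<Rightarrow> 'n connection) \<Rightarrow> bool" where
  "torsion_free A \<Gamma> \<longleftrightarrow> (\<forall>\<kappa>\<in>A. \<forall>q\<in>coord_range \<kappa>. \<forall>c a b. \<Gamma> \<kappa> c a b q = \<Gamma> \<kappa> c b a q)"

section \<open>Covariant derivatives in a chart\<close>

text \<open>In all four definitions \<open>a\<close> is the index of differentiation; the last one is for tensors
  with a lower index \<open>b\<close> and an upper index \<open>c\<close>.\<close>

definition nabla_vec :: "'n::finite connection \<Rightarrow> 'n tensor1 \<Rightarrow> 'n \<Rightarrow> 'n tensor1" where
  "nabla_vec \<Gamma> v a c p = partial a (v c) p + (\<Sum>e\<in>UNIV. \<Gamma> c a e p * v e p)"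

definition nabla_covec :: "'n::finite connection \<Rightarrow> 'n tensor1 \<Rightarrow> 'n \<Rightarrow> 'n tensor1" where
  "nabla_covec \<Gamma> u a b p = partial a (u b) p - (\<Sum>e\<in>UNIV. \<Gamma> e a b p * u e p)"

definition nabla_cov2 :: "'n::finite connection \<Rightarrow> 'n tensor2 \<Rightarrow> 'n \<Rightarrow> 'n tensor2" where
  "nabla_cov2 \<Gamma> T a b d p = partial a (T b d) p
     - (\<Sum>e\<in>UNIV. \<Gamma> e a b p * T e d p) - (\<Sum>e\<in>UNIV. \<Gamma> e a d p * T b e p)"

definition nabla_mixed :: "'n::finite connection \<Rightarrow> 'n tensor2 \<Rightarrow> 'n \<Rightarrow> 'n tensor2" where
  "nabla_mixed \<Gamma> T a b c p = partial a (T b c) p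
     - (\<Sum>e\<in>UNIV. \<Gamma> e a b p * T e c p) + (\<Sum>e\<in>UNIV. \<Gamma> c a e p * T b e p)"

definition coord_vec :: "'n::finite \<Rightarrow> 'n tensor1" where
  "coord_vec d = (\<lambda>c p. if c = d then 1 else 0)"

text \<open>\<open>curvature \<Gamma> a b c d\<close> has lower indices \<open>a b d\<close> and upper index \<open>c\<close>. It is the commutator
  of covariant derivatives applied to the \<open>d\<close>-th coordinate vector field; see \<open>ricci_identity\<close>
  below for arbitrary vector fields.\<close>

definition curvature :: "'n::finite connection \<Rightarrow> 'n \<Rightarrow> 'n \<Rightarrow> 'n \<Rightarrow> 'n \<Rightarrow> real^'n \<Rightarrow> real" where
  "curvature \<Gamma> a b c d p =
     nabla_mixed \<Gamma> (nabla_vec \<Gamma> (coord_vec d)) a b c p -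
     nabla_mixed \<Gamma> (nabla_vec \<Gamma> (coord_vec d)) b a c p"

definition ricci :: "'n::finite connection \<Rightarrow> 'n tensor2" where
  "ricci \<Gamma> a b p = (\<Sum>c\<in>UNIV. curvature \<Gamma> c a c b p)"

section \<open>Projective Schouten, Weyl and Cotton tensors\<close>

definition kron :: "'n \<Rightarrow> 'n \<Rightarrow> real" where
  "kron c d = (if c = d then 1 else 0)"

definition totally_trace_free :: "('n::finite \<Rightarrow> 'n \<Rightarrow> 'n \<Rightarrow> 'n \<Rightarrow> real) \<Rightarrow> bool" where
  "totally_trace_free W \<longleftrightarrow>
     (\<forall>b d. (\<Sum>a\<in>UNIV. W a b a d) = 0) \<and>
     (\<forall>a d. (\<Sum>b\<in>UNIV. W a b b d) = 0) \<and>
     (\<forall>a b. (\<Sum>c\<in>UNIV. W a b c c) = 0)"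

definition projective_decomposition ::
  "('n::finite \<Rightarrow> 'n \<Rightarrow> 'n \<Rightarrow> 'n \<Rightarrow> real) \<Rightarrow>
   ('n \<Rightarrow> 'n \<Rightarrow> 'n \<Rightarrow> 'n \<Rightarrow> real) \<Rightarrow> ('n \<Rightarrow> 'n \<Rightarrow> real) \<Rightarrow> ('n \<Rightarrow> 'n \<Rightarrow> real) \<Rightarrow> bool" where
  "projective_decomposition R W P \<beta> \<longleftrightarrow>
     (\<forall>a b c d. R a b c d =
        W a b c d + (kron c a * P b d - kron c b * P a d) + \<beta> a b * kron c d) \<and>
     totally_trace_free W \<and>
     (\<forall>a b. \<beta> a b = - (P a b - P b a))"

text \<open>Existence and uniqueness of the decomposition at every point are proved below
  (\<open>projective_decomposition_curvature\<close>).\<close>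

definition proj_schouten :: "'n::finite connection \<Rightarrow> 'n tensor2" where
  "proj_schouten \<Gamma> a b p =
     (THE P. \<exists>W \<beta>. projective_decomposition (\<lambda>a b c d. curvature \<Gamma> a b c d p) W P \<beta>) a b"

definition proj_weyl :: "'n::finite connection \<Rightarrow> 'n \<Rightarrow> 'n \<Rightarrow> 'n \<Rightarrow> 'n \<Rightarrow> real^'n \<Rightarrow> real" where
  "proj_weyl \<Gamma> a b c d p =
     (THE W. \<exists>P \<beta>. projective_decomposition (\<lambda>a b c d. curvature \<Gamma> a b c d p) W P \<beta>) a b c d"

text \<open>Here the first lower index \<open>d\<close> is the one that is not skew-symmetrised.\<close>

definition proj_cotton :: "'n::finite connection \<Rightarrow> 'n \<Rightarrow> 'n \<Rightarrow> 'n \<Rightarrow> real^'n \<Rightarrow> real" where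
  "proj_cotton \<Gamma> d a b p =
     nabla_cov2 \<Gamma> (proj_schouten \<Gamma>) a b d p - nabla_cov2 \<Gamma> (proj_schouten \<Gamma>) b a d p"

section \<open>Einstein metrics and projective equivalence\<close>

text \<open>\<open>levi_civita_characterization\<close> below shows that this is the unique torsion-free
  connection with respect to which \<open>g\<close> is parallel.\<close>

definition levi_civita :: "'n::finite tensor2 \<Rightarrow> 'n connection" where
  "levi_civita g c a b p =
     (\<Sum>d\<in>UNIV. matrix_inv (\<chi> a b. g a b p) $ c $ d *
       (partial a (g b d) p + partial b (g a d) p - partial d (g a b) p)) / 2"

definition einstein ::
  "('a, 'n::finite) chart set \<Rightarrow> (('a, 'n) chart \<Rightarrow> 'n tensor2) \<Rightarrow> bool" where
  "einstein A g \<longleftrightarrow> (\<exists>\<mu>::real. \<forall>\<kappa>\<in>A. \<forall>q\<in>coord_range \<kappa>. \<forall>a b.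
     ricci (levi_civita (g \<kappa>)) a b q = \<mu> * g \<kappa> a b q)"

text \<open>The quantified \<open>u\<close> are the local 1-forms defined on the domain of the chart.\<close>

definition projectively_equivalent_via ::
  "('a, 'n::finite) chart set \<Rightarrow> (('a, 'n) chart \<Rightarrow> 'n connection) \<Rightarrow>
   (('a, 'n) chart \<Rightarrow> 'n connection) \<Rightarrow> (('a, 'n) chart \<Rightarrow> 'n tensor1) \<Rightarrow> bool" where
  "projectively_equivalent_via A \<Gamma> \<Gamma>' \<Upsilon> \<longleftrightarrow>
     (\<forall>\<kappa>\<in>A. \<forall>u. (\<forall>b. smooth_on (coord_range \<kappa>) (u b)) \<longrightarrow>
        (\<forall>q\<in>coord_range \<kappa>. \<forall>a b.
           nabla_covec (\<Gamma>' \<kappa>) u a b q =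
           nabla_covec (\<Gamma> \<kappa>) u a b q - \<Upsilon> \<kappa> a q * u b q - \<Upsilon> \<kappa> b q * u a q))"

section \<open>Justification of the definitions\<close>

subsection \<open>Partial derivatives\<close>

lemma has_partial:
  assumes "f differentiable (at (p + t *\<^sub>R axis i 1))"
  shows "((\<lambda>t. f (p + t *\<^sub>R axis i 1)) has_real_derivative partial i f (p + t *\<^sub>R axis i 1)) (at t)"
proof -
  let ?D = "frechet_derivative f (at (p + t *\<^sub>R axis i 1))"
  have D: "(f has_derivative ?D) (at (p + t *\<^sub>R axis i 1))"
    using assms frechet_derivative_works by blast
  have lin: "linear ?D" using D has_derivative_linear by blast
  have "((\<lambda>t. p + t *\<^sub>R axis i 1) has_derivative (\<lambda>s. s *\<^sub>R axis i 1)) (at t)"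
    by (auto intro!: derivative_eq_intros)
  from diff_chain_at[OF this D]
  have "((\<lambda>t. f (p + t *\<^sub>R axis i 1)) has_derivative (\<lambda>s. s *\<^sub>R ?D (axis i 1))) (at t)"
    using lin by (simp add: o_def linear_cmul)
  thus ?thesis
    unfolding has_field_derivative_def partial_def
    by (simp add: mult_commute_abs)
qed

lemma partial_add:
  assumes "f differentiable (at p)" "g differentiable (at p)"
  shows "partial i (\<lambda>x. f x + g x) p = partial i f p + partial i g p"
proof -
  have "((\<lambda>x. f x + g x) has_derivative
     (\<lambda>h. frechet_derivative f (at p) h + frechet_derivative g (at p) h)) (at p)"
    using assms by (intro has_derivative_add) (auto simp: frechet_derivative_works[symmetric])
  from frechet_derivative_at[OF this, symmetric] show ?thesis by (simp add: partial_def)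
qed

lemma partial_mult:
  assumes "f differentiable (at p)" "g differentiable (at p)"
  shows "partial i (\<lambda>x. f x * g x) p = f p * partial i g p + partial i f p * g p"
proof -
  have "((\<lambda>x. f x * g x) has_derivative
     (\<lambda>h. f p * frechet_derivative g (at p) h + frechet_derivative f (at p) h * g p)) (at p)"
    using assms by (intro has_derivative_mult) (auto simp: frechet_derivative_works[symmetric])
  from frechet_derivative_at[OF this, symmetric] show ?thesis by (simp add: partial_def)
qed

lemma partial_sum:
  assumes "finite I" "\<And>j. j \<in> I \<Longrightarrow> f j differentiable (at p)"
  shows "partial i (\<lambda>x. \<Sum>j\<in>I. f j x) p = (\<Sum>j\<in>I. partial i (f j) p)"
proof -
  have "((\<lambda>x. \<Sum>j\<in>I. f j x) has_derivative (\<lambda>h. \<Sum>j\<in>I. frechet_derivative (f j) (at p) h)) (at p)"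
    using assms by (intro has_derivative_sum) (auto simp: frechet_derivative_works[symmetric])
  from frechet_derivative_at[OF this, symmetric] show ?thesis by (simp add: partial_def)
qed

lemma partial_const: "partial i (\<lambda>x. c) p = 0"
  by (simp add: partial_def)

lemma Ck_on_const: "Ck_on k S (\<lambda>x. c)"
proof (induction k arbitrary: c)
  case (Suc k)
  have "partial i (\<lambda>x. c) = (\<lambda>x. 0)" for i :: 'a by (simp add: fun_eq_iff partial_const)
  thus ?case using Suc by simp
qed simp

lemma smooth_on_const: "smooth_on S (\<lambda>x. c)"
  by (simp add: smooth_on_def Ck_on_const)

lemma smooth_on_partial: "smooth_on S f \<Longrightarrow> smooth_on S (partial i f)"
  unfolding smooth_on_def by (metis Ck_on.simps(2))

lemma smooth_on_differentiable:
  assumes "smooth_on S f" "open S" "p \<in> S" shows "f differentiable (at p)"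
proof -
  have "Ck_on (Suc 0) S f" using assms smooth_on_def by blast
  thus ?thesis using assms by (simp add: differentiable_on_eq_differentiable_at)
qed

lemma second_difference:
  fixes f :: "real^'n::finite \<Rightarrow> real"
  assumes f: "smooth_on S f" and S: "open S" and h: "h > 0" and sub: "cball p (2 * h) \<subseteq> S"
  shows "\<exists>q\<in>cball p (2 * h). f (p + h *\<^sub>R axis i 1 + h *\<^sub>R axis j 1) - f (p + h *\<^sub>R axis i 1)
     - f (p + h *\<^sub>R axis j 1) + f p = h\<^sup>2 * partial j (partial i f) q"
proof -
  have inb: "p + s *\<^sub>R axis i 1 + t *\<^sub>R axis j 1 \<in> cball p (2 * h)"
    if "0 \<le> s" "s \<le> h" "0 \<le> t" "t \<le> h" for s t
  proof -
    have "norm (s *\<^sub>R axis i 1 + t *\<^sub>R axis j (1::real)) \<le> 2 * h"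
      using norm_triangle_ineq[of "s *\<^sub>R axis i (1::real)" "t *\<^sub>R axis j (1::real)"] that by simp
    moreover have "p - (p + s *\<^sub>R axis i 1 + t *\<^sub>R axis j 1) = - (s *\<^sub>R axis i 1 + t *\<^sub>R axis j 1)"
      by simp
    ultimately show ?thesis by (simp only: mem_cball dist_norm norm_minus_cancel)
  qed
  have diff: "g differentiable (at (p + s *\<^sub>R axis i 1 + t *\<^sub>R axis j 1))"
    if "smooth_on S g" "0 \<le> s" "s \<le> h" "0 \<le> t" "t \<le> h" for s t g
    using smooth_on_differentiable[OF that(1) S] inb[of s t] that sub by blast
  have swap: "p + h *\<^sub>R axis j 1 + s *\<^sub>R axis i 1 = p + s *\<^sub>R axis i 1 + h *\<^sub>R axis j 1" for s
    by (simp only: ac_simps)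
  let ?\<phi> = "\<lambda>s. f (p + h *\<^sub>R axis j 1 + s *\<^sub>R axis i 1) - f (p + s *\<^sub>R axis i 1)"
  have "\<exists>\<xi>. 0 < \<xi> \<and> \<xi> < h \<and> ?\<phi> h - ?\<phi> 0 = (h - 0) *
     (partial i f (p + h *\<^sub>R axis j 1 + \<xi> *\<^sub>R axis i 1) - partial i f (p + \<xi> *\<^sub>R axis i 1))"
  proof (rule MVT2[OF h])
    fix s assume s: "0 \<le> s" "s \<le> h"
    have "f differentiable (at (p + h *\<^sub>R axis j 1 + s *\<^sub>R axis i 1))"
      unfolding swap using diff[OF f s, of h] h by simp
    moreover have "f differentiable (at (p + s *\<^sub>R axis i 1))"
      using diff[OF f s, of 0] h by simp
    ultimately show "(?\<phi> has_real_derivative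
       (partial i f (p + h *\<^sub>R axis j 1 + s *\<^sub>R axis i 1) - partial i f (p + s *\<^sub>R axis i 1))) (at s)"
      by (intro DERIV_diff has_partial[of f])
  qed
  then obtain \<xi> where \<xi>: "0 < \<xi>" "\<xi> < h" and \<phi>: "?\<phi> h - ?\<phi> 0 = (h - 0) *
     (partial i f (p + h *\<^sub>R axis j 1 + \<xi> *\<^sub>R axis i 1) - partial i f (p + \<xi> *\<^sub>R axis i 1))"
    by (elim exE conjE)
  let ?\<psi> = "\<lambda>t. partial i f (p + \<xi> *\<^sub>R axis i 1 + t *\<^sub>R axis j 1)"
  have "\<exists>\<eta>. 0 < \<eta> \<and> \<eta> < h \<and> ?\<psi> h - ?\<psi> 0 = (h - 0) *
     partial j (partial i f) (p + \<xi> *\<^sub>R axis i 1 + \<eta> *\<^sub>R axis j 1)"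
  proof (rule MVT2[OF h])
    fix t assume "0 \<le> t" "t \<le> h"
    then have "partial i f differentiable (at (p + \<xi> *\<^sub>R axis i 1 + t *\<^sub>R axis j 1))"
      using diff[OF smooth_on_partial[OF f]] \<xi>(1,2) by simp
    then show "(?\<psi> has_real_derivative
        partial j (partial i f) (p + \<xi> *\<^sub>R axis i 1 + t *\<^sub>R axis j 1)) (at t)"
      by (rule has_partial)
  qed
  then obtain \<eta> where \<eta>: "0 < \<eta>" "\<eta> < h" and \<psi>: "?\<psi> h - ?\<psi> 0 = (h - 0) *
     partial j (partial i f) (p + \<xi> *\<^sub>R axis i 1 + \<eta> *\<^sub>R axis j 1)"
    by (elim exE conjE)
  have "f (p + h *\<^sub>R axis i 1 + h *\<^sub>R axis j 1) - f (p + h *\<^sub>R axis i 1)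
     - f (p + h *\<^sub>R axis j 1) + f p = ?\<phi> h - ?\<phi> 0"
    unfolding swap by simp
  also have "\<dots> = h * (?\<psi> h - ?\<psi> 0)" using \<phi> unfolding swap by simp
  also have "\<dots> = h\<^sup>2 * partial j (partial i f) (p + \<xi> *\<^sub>R axis i 1 + \<eta> *\<^sub>R axis j 1)"
    unfolding \<psi> by (simp add: power2_eq_square)
  finally show ?thesis
    by (rule bexI) (rule inb; use \<xi> \<eta> in linarith)
qed

lemma partial_commute:
  fixes f :: "real^'n::finite \<Rightarrow> real"
  assumes f: "smooth_on S f" and S: "open S" and p: "p \<in> S"
  shows "partial i (partial j f) p = partial j (partial i f) p"
proof (rule ccontr)
  let ?F = "partial j (partial i f)" and ?G = "partial i (partial j f)"
  assume ne: "?G p \<noteq> ?F p"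
  define e where "e = \<bar>?G p - ?F p\<bar> / 2"
  have e: "e > 0" using ne by (simp add: e_def)
  have "isCont ?F p" "isCont ?G p"
    using smooth_on_differentiable[OF smooth_on_partial[OF smooth_on_partial[OF f]] S p]
    by (auto intro: differentiable_imp_continuous_within)
  then have "\<exists>d>0. \<forall>x. dist x p < d \<longrightarrow> dist (?F x) (?F p) < e"
    "\<exists>d>0. \<forall>x. dist x p < d \<longrightarrow> dist (?G x) (?G p) < e"
    using e unfolding continuous_at_eps_delta by blast+
  then obtain d1 d2 where d: "d1 > 0" "\<forall>x. dist x p < d1 \<longrightarrow> dist (?F x) (?F p) < e"
    "d2 > 0" "\<forall>x. dist x p < d2 \<longrightarrow> dist (?G x) (?G p) < e"
    by blast
  obtain d3 where d3: "d3 > 0" "cball p d3 \<subseteq> S" using S p open_contains_cball by blast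
  define h where "h = min d3 (min d1 d2) / 4"
  have h: "h > 0" "2 * h < d1" "2 * h < d2" "2 * h \<le> d3" using d d3 by (auto simp: h_def)
  have sub: "cball p (2 * h) \<subseteq> S" using d3 h by auto
  obtain q where q: "q \<in> cball p (2 * h)" "f (p + h *\<^sub>R axis i 1 + h *\<^sub>R axis j 1)
     - f (p + h *\<^sub>R axis i 1) - f (p + h *\<^sub>R axis j 1) + f p = h\<^sup>2 * ?F q"
    using second_difference[OF f S h(1) sub] by blast
  obtain r where r: "r \<in> cball p (2 * h)" "f (p + h *\<^sub>R axis j 1 + h *\<^sub>R axis i 1)
     - f (p + h *\<^sub>R axis j 1) - f (p + h *\<^sub>R axis i 1) + f p = h\<^sup>2 * ?G r"
    using second_difference[OF f S h(1) sub] by blast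
  have "h\<^sup>2 * ?F q = h\<^sup>2 * ?G r"
    using q(2) r(2) by (simp add: algebra_simps)
  hence "?F q = ?G r" using h by simp
  moreover have "dist q p < d1" "dist r p < d2"
    using q(1) r(1) h by (simp_all add: dist_commute)
  then have "\<bar>?F q - ?F p\<bar> < e" "\<bar>?G r - ?G p\<bar> < e"
    using d unfolding dist_real_def by blast+
  ultimately show False unfolding e_def by argo
qed

subsection \<open>The Ricci identity\<close>

definition curvature_components ::
  "'n::finite connection \<Rightarrow> 'n \<Rightarrow> 'n \<Rightarrow> 'n \<Rightarrow> 'n \<Rightarrow> real^'n \<Rightarrow> real" where
  "curvature_components \<Gamma> a b c d p = partial a (\<Gamma> c b d) p - partial b (\<Gamma> c a d) p +
     (\<Sum>e\<in>UNIV. \<Gamma> c a e p * \<Gamma> e b d p - \<Gamma> c b e p * \<Gamma> e a d p)"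

lemma partial_nabla_vec:
  assumes S: "open S" "p \<in> S" and \<Gamma>: "\<And>c a b. smooth_on S (\<Gamma> c a b)"
    and v: "\<And>c. smooth_on S (v c)"
  shows "partial a (nabla_vec \<Gamma> v b c) p = partial a (partial b (v c)) p +
    (\<Sum>d\<in>UNIV. \<Gamma> c b d p * partial a (v d) p + partial a (\<Gamma> c b d) p * v d p)"
proof -
  note [simp] = smooth_on_differentiable[OF \<Gamma> S] smooth_on_differentiable[OF v S]
    smooth_on_differentiable[OF smooth_on_partial[OF v] S]
  have "nabla_vec \<Gamma> v b c = (\<lambda>p. partial b (v c) p + (\<Sum>e\<in>UNIV. \<Gamma> c b e p * v e p))"
    by (simp add: fun_eq_iff nabla_vec_def)
  thus ?thesis
    by (simp add: partial_add partial_sum partial_mult differentiable_sum)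
qed

lemma commutator_components:
  assumes S: "open S" "p \<in> S" and \<Gamma>: "\<And>c a b. smooth_on S (\<Gamma> c a b)"
    and sym: "\<And>c a b. \<Gamma> c a b p = \<Gamma> c b a p"
    and v: "\<And>c. smooth_on S (v c)"
  shows "nabla_mixed \<Gamma> (nabla_vec \<Gamma> v) a b c p - nabla_mixed \<Gamma> (nabla_vec \<Gamma> v) b a c p =
    (\<Sum>d\<in>UNIV. curvature_components \<Gamma> a b c d p * v d p)"
proof -
  have sw: "(\<Sum>e\<in>UNIV. \<Gamma> c a e p * (\<Sum>d\<in>UNIV. \<Gamma> e b d p * v d p)) =
     (\<Sum>d\<in>UNIV. (\<Sum>e\<in>UNIV. \<Gamma> c a e p * \<Gamma> e b d p) * v d p)" for a b
    unfolding sum_distrib_left sum_distrib_right by (subst sum.swap) (simp only: mult.assoc)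
  have exp: "nabla_mixed \<Gamma> (nabla_vec \<Gamma> v) a b c p = partial a (partial b (v c)) p
     + (\<Sum>d\<in>UNIV. \<Gamma> c b d p * partial a (v d) p) + (\<Sum>d\<in>UNIV. partial a (\<Gamma> c b d) p * v d p)
     - (\<Sum>e\<in>UNIV. \<Gamma> e a b p * nabla_vec \<Gamma> v e c p)
     + (\<Sum>d\<in>UNIV. \<Gamma> c a d p * partial b (v d) p)
     + (\<Sum>d\<in>UNIV. (\<Sum>e\<in>UNIV. \<Gamma> c a e p * \<Gamma> e b d p) * v d p)" for a b
  proof -
    have "(\<Sum>e\<in>UNIV. \<Gamma> c a e p * nabla_vec \<Gamma> v b e p) =
       (\<Sum>d\<in>UNIV. \<Gamma> c a d p * partial b (v d) p)
     + (\<Sum>d\<in>UNIV. (\<Sum>e\<in>UNIV. \<Gamma> c a e p * \<Gamma> e b d p) * v d p)"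
      unfolding nabla_vec_def distrib_left sum.distrib sw by (rule refl)
    moreover have "partial a (nabla_vec \<Gamma> v b c) p = partial a (partial b (v c)) p
     + (\<Sum>d\<in>UNIV. \<Gamma> c b d p * partial a (v d) p) + (\<Sum>d\<in>UNIV. partial a (\<Gamma> c b d) p * v d p)"
      using partial_nabla_vec[OF S \<Gamma> v] by (simp only: sum.distrib add.assoc)
    ultimately show ?thesis unfolding nabla_mixed_def by simp
  qed
  have "(\<Sum>e\<in>UNIV. \<Gamma> e a b p * nabla_vec \<Gamma> v e c p) = (\<Sum>e\<in>UNIV. \<Gamma> e b a p * nabla_vec \<Gamma> v e c p)"
    by (rule sum.cong[OF refl]) (simp only: sym[of _ a b])
  moreover have "partial a (partial b (v c)) p = partial b (partial a (v c)) p"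
    by (rule partial_commute[OF v S])
  moreover have "(\<Sum>d\<in>UNIV. curvature_components \<Gamma> a b c d p * v d p) =
     (\<Sum>d\<in>UNIV. partial a (\<Gamma> c b d) p * v d p) - (\<Sum>d\<in>UNIV. partial b (\<Gamma> c a d) p * v d p)
     + ((\<Sum>d\<in>UNIV. (\<Sum>e\<in>UNIV. \<Gamma> c a e p * \<Gamma> e b d p) * v d p)
     - (\<Sum>d\<in>UNIV. (\<Sum>e\<in>UNIV. \<Gamma> c b e p * \<Gamma> e a d p) * v d p))"
    unfolding curvature_components_def distrib_right left_diff_distrib sum.distrib sum_subtractf
    by (rule refl)
  ultimately show ?thesis unfolding exp[of a b] exp[of b a] by simp
qed

lemma curvature_eq_components:
  assumes "open S" "p \<in> S" "\<And>c a b. smooth_on S (\<Gamma> c a b)"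
    and "\<And>c a b. \<Gamma> c a b p = \<Gamma> c b a p"
  shows "curvature \<Gamma> a b c d p = curvature_components \<Gamma> a b c d p"
proof -
  have "smooth_on S (coord_vec d c)" for c by (simp add: coord_vec_def smooth_on_const)
  from commutator_components[where v = "coord_vec d", OF assms this]
  show ?thesis
    by (simp add: curvature_def coord_vec_def if_distrib[of "\<lambda>x. _ * x"] cong: if_cong)
qed

lemma ricci_identity:
  assumes "open S" "p \<in> S" "\<And>c a b. smooth_on S (\<Gamma> c a b)"
    and "\<And>c a b. \<Gamma> c a b p = \<Gamma> c b a p" and "\<And>c. smooth_on S (v c)"
  shows "nabla_mixed \<Gamma> (nabla_vec \<Gamma> v) a b c p - nabla_mixed \<Gamma> (nabla_vec \<Gamma> v) b a c p =
    (\<Sum>d\<in>UNIV. curvature \<Gamma> a b c d p * v d p)"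
  using commutator_components[OF assms] curvature_eq_components[OF assms(1-4)] by simp

subsection \<open>The projective decomposition\<close>

lemma sum_kron [simp]:
  "(\<Sum>a\<in>UNIV. kron a b * f a) = f b" "(\<Sum>a\<in>UNIV. kron b a * f a) = f b"
  "(\<Sum>a\<in>UNIV. f a * kron a b) = f b" "(\<Sum>a\<in>UNIV. f a * kron b a) = f b"
  "kron b b = 1" for b :: "'n::finite"
  by (simp_all add: kron_def if_distrib[of "\<lambda>x. _ * x"] if_distrib[of "\<lambda>x. x * _"] cong: if_cong)

lemma projective_decomposition_ricci:
  fixes R :: "'n::finite \<Rightarrow> 'n \<Rightarrow> 'n \<Rightarrow> 'n \<Rightarrow> real"
  assumes "projective_decomposition R W P \<beta>"
  shows "(real CARD('n) - 1) * P a b = (\<Sum>c\<in>UNIV. R c a c b) + \<beta> a b"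
proof -
  have R: "R c a c b = W c a c b + (P a b - kron c a * P c b) + \<beta> c a * kron c b" for c
    using assms by (simp add: projective_decomposition_def)
  have "(\<Sum>c\<in>UNIV. R c a c b) = (real CARD('n) - 1) * P a b + \<beta> b a"
    using assms unfolding R projective_decomposition_def totally_trace_free_def
    by (simp add: sum.distrib sum_subtractf left_diff_distrib)
  moreover have "\<beta> b a = - \<beta> a b" using assms by (simp add: projective_decomposition_def)
  ultimately show ?thesis by simp
qed

lemma projective_decomposition_explicit:
  fixes R :: "'n::finite \<Rightarrow> 'n \<Rightarrow> 'n \<Rightarrow> 'n \<Rightarrow> real"
  assumes n: "CARD('n) \<ge> 2" and D: "projective_decomposition R W P \<beta>"
  defines "\<rho> \<equiv> \<lambda>a b. \<Sum>c\<in>UNIV. R c a c b"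
  shows "P a b = (\<rho> a b + \<rho> b a) / (2 * (real CARD('n) - 1)) +
                 (\<rho> a b - \<rho> b a) / (2 * (real CARD('n) + 1))"
proof -
  let ?n = "real CARD('n)"
  have n: "?n \<ge> 2" using n by linarith
  have \<beta>: "\<beta> a b = P b a - P a b" "\<beta> b a = P a b - P b a"
    using D by (auto simp: projective_decomposition_def)
  have "(?n - 1) * P a b = \<rho> a b + \<beta> a b" "(?n - 1) * P b a = \<rho> b a + \<beta> b a"
    using projective_decomposition_ricci[OF D] by (auto simp: \<rho>_def)
  hence "\<rho> a b + \<rho> b a = (?n - 1) * (P a b + P b a)" "\<rho> a b - \<rho> b a = (?n + 1) * (P a b - P b a)"
    unfolding \<beta> by (auto simp: algebra_simps)
  hence "P a b + P b a = (\<rho> a b + \<rho> b a) / (?n - 1)" "P a b - P b a = (\<rho> a b - \<rho> b a) / (?n + 1)"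
    using n by simp_all
  moreover have "P a b = (P a b + P b a) / 2 + (P a b - P b a) / 2" by (simp add: field_simps)
  ultimately have "P a b = (\<rho> a b + \<rho> b a) / (?n - 1) / 2 + (\<rho> a b - \<rho> b a) / (?n + 1) / 2"
    by metis
  thus ?thesis by (simp only: divide_divide_eq_left mult.commute)
qed

lemma projective_decomposition_unique:
  fixes R :: "'n::finite \<Rightarrow> 'n \<Rightarrow> 'n \<Rightarrow> 'n \<Rightarrow> real"
  assumes n: "CARD('n) \<ge> 2"
    and D: "projective_decomposition R W P \<beta>" and D': "projective_decomposition R W' P' \<beta>'"
  shows "W = W' \<and> P = P' \<and> \<beta> = \<beta>'"
proof -
  have P: "P = P'"
    using projective_decomposition_explicit[OF n D] projective_decomposition_explicit[OF n D']
    by (simp add: fun_eq_iff)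
  moreover have \<beta>: "\<beta> = \<beta>'"
    using D D' P by (simp add: projective_decomposition_def fun_eq_iff)
  moreover have "W a b c d = W' a b c d" for a b c d
  proof -
    have "R a b c d = W a b c d + (kron c a * P b d - kron c b * P a d) + \<beta> a b * kron c d"
      using D by (simp add: projective_decomposition_def)
    moreover have "R a b c d = W' a b c d + (kron c a * P b d - kron c b * P a d) + \<beta> a b * kron c d"
      using D' P \<beta> by (simp add: projective_decomposition_def)
    ultimately show ?thesis by simp
  qed
  ultimately show ?thesis by (simp add: fun_eq_iff)
qed

lemma projective_decomposition_exists:
  fixes R :: "'n::finite \<Rightarrow> 'n \<Rightarrow> 'n \<Rightarrow> 'n \<Rightarrow> real"
  assumes n: "CARD('n) \<ge> 2"
    and skew: "\<And>a b c d. R b a c d = - R a b c d"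
    and bianchi: "\<And>a b c d. R a b c d + R b d c a + R d a c b = 0"
  shows "\<exists>W P \<beta>. projective_decomposition R W P \<beta>"
proof -
  let ?n = "real CARD('n)"
  have n2: "?n \<ge> 2" using n by linarith
  define \<rho> where "\<rho> a b = (\<Sum>c\<in>UNIV. R c a c b)" for a b
  define P where "P a b = (\<rho> a b + \<rho> b a) / (2 * (?n - 1)) + (\<rho> a b - \<rho> b a) / (2 * (?n + 1))"
    for a b
  define \<beta> where "\<beta> a b = - (P a b - P b a)" for a b
  define W where "W a b c d = R a b c d - (kron c a * P b d - kron c b * P a d) - \<beta> a b * kron c d"
    for a b c d
  have s: "P a b + P b a = (\<rho> a b + \<rho> b a) / (?n - 1)"
    and k: "P a b - P b a = (\<rho> a b - \<rho> b a) / (?n + 1)" for a b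
    using n2 by (simp_all add: P_def divide_simps) (simp_all add: algebra_simps)
  have \<rho>: "\<rho> a b = (?n - 1) * P a b - \<beta> a b" for a b
  proof -
    have "\<rho> a b + \<rho> b a = (?n - 1) * (P a b + P b a)" "\<rho> a b - \<rho> b a = (?n + 1) * (P a b - P b a)"
      using n2 by (simp_all add: s k)
    thus ?thesis by (simp add: \<beta>_def algebra_simps)
  qed
  have t1: "(\<Sum>a\<in>UNIV. W a b a d) = 0" for b d
  proof -
    have "(\<Sum>a\<in>UNIV. W a b a d) = \<rho> b d - (?n * P b d - P b d) - \<beta> d b"
      by (simp add: W_def \<rho>_def sum_subtractf)
    thus ?thesis by (simp add: \<rho> \<beta>_def algebra_simps)
  qed
  have W: "W a b c d = - W b a c d" for a b c d
    using skew[of a b c d] by (simp add: W_def \<beta>_def algebra_simps)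
  have t2: "(\<Sum>b\<in>UNIV. W a b b d) = 0" for a d
    using t1[of a d] by (simp add: W[of a] sum_negf)
  have tr: "(\<Sum>c\<in>UNIV. R a b c c) = \<rho> b a - \<rho> a b" for a b
  proof -
    have "R a b c c = R c b c a - R c a c b" for c
      using bianchi[of a b c c] skew[of b c c a] by simp
    thus ?thesis by (simp add: \<rho>_def sum_subtractf)
  qed
  have t3: "(\<Sum>c\<in>UNIV. W a b c c) = 0" for a b
  proof -
    have "(\<Sum>c\<in>UNIV. W a b c c) = \<rho> b a - \<rho> a b - (P b a - P a b) - ?n * \<beta> a b"
      by (simp add: W_def tr sum_subtractf)
    thus ?thesis by (simp add: \<rho> \<beta>_def algebra_simps)
  qed
  have "projective_decomposition R W P \<beta>"
    unfolding projective_decomposition_def totally_trace_free_def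
    by (simp add: t1 t2 t3) (simp add: W_def \<beta>_def)
  thus ?thesis by blast
qed

lemma projective_decomposition_curvature:
  fixes \<Gamma> :: "'n::finite connection"
  assumes n: "CARD('n) \<ge> 2" and S: "open S" "p \<in> S" and \<Gamma>: "\<And>c a b. smooth_on S (\<Gamma> c a b)"
    and sym: "\<And>q c a b. q \<in> S \<Longrightarrow> \<Gamma> c a b q = \<Gamma> c b a q"
  shows "\<exists>\<beta>. projective_decomposition (\<lambda>a b c d. curvature \<Gamma> a b c d p)
    (\<lambda>a b c d. proj_weyl \<Gamma> a b c d p) (\<lambda>a b. proj_schouten \<Gamma> a b p) \<beta>"
proof -
  let ?R = "\<lambda>a b c d. curvature \<Gamma> a b c d p"
  have comp: "?R a b c d = curvature_components \<Gamma> a b c d p" for a b c d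
    by (rule curvature_eq_components[where \<Gamma> = \<Gamma>, OF S \<Gamma> sym[OF S(2)]])
  have ps: "partial a (\<Gamma> c b d) p = partial a (\<Gamma> c d b) p" for a b c d
  proof -
    have "(\<Gamma> c b d has_derivative D) (at p) \<longleftrightarrow> (\<Gamma> c d b has_derivative D) (at p)" for D
      using has_derivative_transform_within_open[OF _ S] sym by metis
    thus ?thesis by (simp add: partial_def frechet_derivative_def)
  qed
  have "?R b a c d = - ?R a b c d" for a b c d by (simp add: curvature_def)
  moreover have "?R a b c d + ?R b d c a + ?R d a c b = 0" for a b c d
    unfolding comp curvature_components_def sum_subtractf
    using ps[of a c b d] ps[of b c a d] ps[of d c a b]
    by (simp add: sym[OF S(2), of _ b d] sym[OF S(2), of _ a d] sym[OF S(2), of _ b a])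
  ultimately obtain W P \<beta> where D: "projective_decomposition ?R W P \<beta>"
    using projective_decomposition_exists[OF n, of ?R] by blast
  have "(THE P. \<exists>W \<beta>. projective_decomposition ?R W P \<beta>) = P"
    using D projective_decomposition_unique[OF n D] by (intro the_equality) blast+
  moreover have "(THE W. \<exists>P \<beta>. projective_decomposition ?R W P \<beta>) = W"
    using D projective_decomposition_unique[OF n D] by (intro the_equality) blast+
  ultimately show ?thesis using D by (auto simp: proj_weyl_def proj_schouten_def)
qed

subsection \<open>The Levi-Civita connection\<close>

lemma levi_civita_characterization:
  fixes g :: "'n::finite tensor2"
  assumes S: "open S" "p \<in> S" and sym: "\<And>q a b. q \<in> S \<Longrightarrow> g a b q = g b a q"
    and inv: "invertible (\<chi> a b. g a b p)"
  shows "(\<forall>c a b. \<Gamma> c a b p = \<Gamma> c b a p) \<and> (\<forall>a b d. nabla_cov2 \<Gamma> g a b d p = 0) \<longleftrightarrow>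
    (\<forall>c a b. \<Gamma> c a b p = levi_civita g c a b p)"
proof -
  let ?G = "\<chi> a b. g a b p"
  have ps: "partial a (g b d) p = partial a (g d b) p" for a b d
  proof -
    have "(g b d has_derivative D) (at p) \<longleftrightarrow> (g d b has_derivative D) (at p)" for D
      using has_derivative_transform_within_open[OF _ S] sym by metis
    thus ?thesis by (simp add: partial_def frechet_derivative_def)
  qed
  note gs = sym[OF S(2)]
  have I: "matrix_inv ?G ** ?G = mat 1" "?G ** matrix_inv ?G = mat 1"
    using someI_ex[OF inv[unfolded invertible_def]] by (auto simp: matrix_inv_def)
  define L where "L a b d = (partial a (g b d) p + partial b (g a d) p - partial d (g a b) p) / 2"
    for a b d
  have lc: "levi_civita g c a b p = (matrix_inv ?G *v (\<chi> d. L a b d)) $ c" for c a b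
    by (simp add: levi_civita_def matrix_vector_mult_def L_def sum_divide_distrib)
  define K where "K a b d = (\<Sum>e\<in>UNIV. \<Gamma> e a b p * g e d p)" for a b d
  have K: "K a b d = (?G *v (\<chi> e. \<Gamma> e a b p)) $ d" for a b d
    by (simp add: K_def matrix_vector_mult_def gs[of d] mult.commute)
  have eqv: "(\<forall>c a b. \<Gamma> c a b p = levi_civita g c a b p) \<longleftrightarrow> (\<forall>a b d. K a b d = L a b d)"
  proof
    assume "\<forall>c a b. \<Gamma> c a b p = levi_civita g c a b p"
    hence "(\<chi> e. \<Gamma> e a b p) = matrix_inv ?G *v (\<chi> d. L a b d)" for a b
      by (simp add: lc vec_eq_iff)
    thus "\<forall>a b d. K a b d = L a b d"
      by (simp add: K matrix_vector_mul_assoc I)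
  next
    assume "\<forall>a b d. K a b d = L a b d"
    hence "(\<chi> d. L a b d) = ?G *v (\<chi> e. \<Gamma> e a b p)" for a b
      by (simp add: K vec_eq_iff)
    thus "\<forall>c a b. \<Gamma> c a b p = levi_civita g c a b p"
      by (simp add: lc matrix_vector_mul_assoc I)
  qed
  have nab: "nabla_cov2 \<Gamma> g a b d p = partial a (g b d) p - K a b d - K a d b" for a b d
    by (simp add: nabla_cov2_def K_def gs[of b])
  have symK: "(\<forall>c a b. \<Gamma> c a b p = \<Gamma> c b a p) \<longleftrightarrow> (\<forall>a b d. K a b d = K b a d)"
  proof
    assume h: "\<forall>a b d. K a b d = K b a d"
    have "(\<chi> e. \<Gamma> e a b p) = (\<chi> e. \<Gamma> e b a p)" for a b
    proof -
      have "?G *v (\<chi> e. \<Gamma> e a b p) = ?G *v (\<chi> e. \<Gamma> e b a p)"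
        using h by (simp add: K vec_eq_iff)
      hence "matrix_inv ?G *v (?G *v (\<chi> e. \<Gamma> e a b p)) = matrix_inv ?G *v (?G *v (\<chi> e. \<Gamma> e b a p))"
        by simp
      thus ?thesis by (simp add: matrix_vector_mul_assoc I)
    qed
    thus "\<forall>c a b. \<Gamma> c a b p = \<Gamma> c b a p" by (simp add: vec_eq_iff)
  next
    assume h: "\<forall>c a b. \<Gamma> c a b p = \<Gamma> c b a p"
    show "\<forall>a b d. K a b d = K b a d"
    proof (intro allI)
      fix a b d
      have "\<Gamma> e a b p = \<Gamma> e b a p" for e using h by blast
      thus "K a b d = K b a d" by (simp add: K_def)
    qed
  qed
  show ?thesis unfolding eqv symK nab
  proof (intro iffI conjI allI)
    fix a b d
    assume h: "(\<forall>a b d. K a b d = K b a d) \<and> (\<forall>a b d. partial a (g b d) p - K a b d - K a d b = 0)"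
    hence "partial a (g b d) p - K a b d - K a d b = 0" "partial b (g a d) p - K b a d - K b d a = 0"
      "partial d (g a b) p - K d a b - K d b a = 0" "K a b d = K b a d" "K d a b = K a d b"
      "K d b a = K b d a"
      by blast+
    thus "K a b d = L a b d" unfolding L_def by simp
  next
    fix a b d assume h: "\<forall>a b d. K a b d = L a b d"
    show "K a b d = K b a d" using ps[of d a b] by (simp add: h L_def)
    show "partial a (g b d) p - K a b d - K a d b = 0"
      unfolding h[rule_format] L_def
      using ps[of a d b] ps[of b d a] ps[of d b a] ps[of b a d] by argo
  qed
qed

end

theory Submission
  imports Defs
begin

text \<open>If \<open>\<nabla>'\<close> is the projectively equivalent connection, then its curvature differs from that
  of \<open>\<nabla>\<close> by Kronecker delta terms, so the two connections share their Weyl tensor and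
  \<open>P = P' + \<nabla>\<Upsilon> - \<Upsilon> \<otimes> \<Upsilon>\<close>. For an Einstein metric \<open>P'\<close> is a constant multiple of \<open>g\<close>, and
  \<open>\<nabla>'g = 0\<close> gives \<open>\<nabla>\<^sub>a g\<^sub>b\<^sub>d - \<nabla>\<^sub>b g\<^sub>a\<^sub>d = \<Upsilon>\<^sub>a g\<^sub>b\<^sub>d - \<Upsilon>\<^sub>b g\<^sub>a\<^sub>d\<close>. The Cotton tensor is the
  skew-symmetrised covariant derivative of \<open>P\<close>; by the Ricci identity its second-order term in
  \<open>\<Upsilon>\<close> is minus the curvature contracted with \<open>\<Upsilon>\<close>, and all terms but the Weyl one cancel.\<close>

section \<open>Calculus on open sets: partial derivatives and closure properties of smooth
  functions\<close>

text \<open>Derivatives are local. Components are meaningful only on the coordinate range, so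
  identities between them are known just there; openness of that range is what permits
  differentiating them.\<close>

lemma partial_cong_open:
  assumes "open S" "p \<in> S" "\<And>q. q \<in> S \<Longrightarrow> f q = h q"
  shows "partial i f p = partial i h p"
proof -
  have "(f has_derivative D) (at p) \<longleftrightarrow> (h has_derivative D) (at p)" for D
    using has_derivative_transform_within_open[OF _ assms(1,2)] assms(3) by metis
  thus ?thesis by (simp add: partial_def frechet_derivative_def)
qed

lemma partial_cmult:
  assumes "f differentiable (at p)"
  shows "partial i (\<lambda>x. c * f x) p = c * partial i f p"
proof -
  have "partial i (\<lambda>x. c * f x) p = c * partial i f p + partial i (\<lambda>x. c) p * f p"
    by (rule partial_mult[OF _ assms]) simp
  thus ?thesis by (simp add: partial_const)
qed

lemma partial_diff:
  assumes "f differentiable (at p)" "h differentiable (at p)"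
  shows "partial i (\<lambda>x. f x - h x) p = partial i f p - partial i h p"
proof -
  have "((\<lambda>x. f x - h x) has_derivative
     (\<lambda>v. frechet_derivative f (at p) v - frechet_derivative h (at p) v)) (at p)"
    using assms by (intro has_derivative_diff) (auto simp: frechet_derivative_works[symmetric])
  from frechet_derivative_at[OF this, symmetric] show ?thesis by (simp add: partial_def)
qed

text \<open>Supports the inductions that follow: the rules for partial derivatives of sums and
  multiples require differentiability, hence identify \<open>partial i\<close> of the compound
  function only at points of \<open>S\<close>.\<close>

lemma Ck_on_cong:
  assumes S: "open S"
  shows "Ck_on k S f \<Longrightarrow> (\<And>q. q \<in> S \<Longrightarrow> f q = h q) \<Longrightarrow> Ck_on k S h"
proof (induction k arbitrary: f h)
  case 0
  thus ?case by (simp cong: continuous_on_cong)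
next
  case (Suc k)
  have f: "f differentiable_on S" "Ck_on k S (partial i f)" for i
    using Suc.prems(1) by simp_all
  have "partial i f q = partial i h q" if "q \<in> S" for i q
    by (rule partial_cong_open[OF S that Suc.prems(2)])
  hence "Ck_on k S (partial i h)" for i
    by (rule Suc.IH[OF f(2)])
  moreover have "h differentiable_on S"
    using f(1) Suc.prems(2) unfolding differentiable_on_def
    by (metis differentiable_transform_within zero_less_one)
  ultimately show ?case by simp
qed

lemma Ck_on_add:
  assumes S: "open S"
  shows "Ck_on k S f \<Longrightarrow> Ck_on k S h \<Longrightarrow> Ck_on k S (\<lambda>q. f q + h q)"
proof (induction k arbitrary: f h)
  case 0
  thus ?case by (simp add: continuous_on_add)
next
  case (Suc k)
  have d: "f differentiable_on S" "h differentiable_on S"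
    and p: "Ck_on k S (partial i f)" "Ck_on k S (partial i h)" for i
    using Suc.prems by simp_all
  have "partial i f q + partial i h q = partial i (\<lambda>q. f q + h q) q" if "q \<in> S" for i q
    by (rule partial_add[symmetric]; use d S that differentiable_on_eq_differentiable_at in blast)
  hence "Ck_on k S (partial i (\<lambda>q. f q + h q))" for i
    by (rule Ck_on_cong[OF S Suc.IH[OF p]])
  thus ?case using d by (simp add: differentiable_on_add)
qed

lemma Ck_on_cmult:
  assumes S: "open S"
  shows "Ck_on k S f \<Longrightarrow> Ck_on k S (\<lambda>q. c * f q)"
proof (induction k arbitrary: f)
  case 0
  thus ?case by (simp add: continuous_on_mult_left)
next
  case (Suc k)
  have d: "f differentiable_on S" and p: "Ck_on k S (partial i f)" for i
    using Suc.prems by simp_all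
  have "c * partial i f q = partial i (\<lambda>q. c * f q) q" if "q \<in> S" for i q
    by (rule partial_cmult[symmetric]; use d S that differentiable_on_eq_differentiable_at in blast)
  hence "Ck_on k S (partial i (\<lambda>q. c * f q))" for i
    by (rule Ck_on_cong[OF S Suc.IH[OF p]])
  thus ?case using d by (simp add: differentiable_on_mult)
qed

lemma smooth_on_add:
  assumes "open S" "smooth_on S f" "smooth_on S h"
  shows "smooth_on S (\<lambda>q. f q + h q)"
  using assms(2,3) unfolding smooth_on_def by (iprover intro: Ck_on_add[OF assms(1)])

lemma smooth_on_cmult:
  assumes "open S" "smooth_on S f"
  shows "smooth_on S (\<lambda>q. c * f q)"
  using assms(2) unfolding smooth_on_def by (iprover intro: Ck_on_cmult[OF assms(1)])

section \<open>The Ricci identity for 1-forms\<close>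

lemma partial_nabla_covec:
  assumes S: "open S" "p \<in> S" and \<Gamma>: "\<And>c a b. smooth_on S (\<Gamma> c a b)"
    and u: "\<And>c. smooth_on S (u c)"
  shows "nabla_covec \<Gamma> u b d differentiable (at p)"
    and "partial a (nabla_covec \<Gamma> u b d) p = partial a (partial b (u d)) p -
    (\<Sum>e\<in>UNIV. \<Gamma> e b d p * partial a (u e) p + partial a (\<Gamma> e b d) p * u e p)"
proof -
  note [simp] = smooth_on_differentiable[OF \<Gamma> S] smooth_on_differentiable[OF u S]
    smooth_on_differentiable[OF smooth_on_partial[OF u] S]
  have eq: "nabla_covec \<Gamma> u b d = (\<lambda>p. partial b (u d) p - (\<Sum>e\<in>UNIV. \<Gamma> e b d p * u e p))"
    by (simp add: fun_eq_iff nabla_covec_def)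
  show "nabla_covec \<Gamma> u b d differentiable (at p)"
    unfolding eq by (simp add: differentiable_sum)
  show "partial a (nabla_covec \<Gamma> u b d) p = partial a (partial b (u d)) p -
    (\<Sum>e\<in>UNIV. \<Gamma> e b d p * partial a (u e) p + partial a (\<Gamma> e b d) p * u e p)"
    unfolding eq by (simp add: partial_diff partial_sum partial_mult differentiable_sum)
qed

text \<open>Skew-symmetrising in \<open>a\<close>, \<open>b\<close> removes second partials by their
  symmetry, the term in \<open>nabla_covec \<Gamma> u e d\<close> by symmetry of \<Gamma>, and the
  terms in first partials of \<open>u\<close> because the two of them together are symmetric. Only
  curvature survives, with the sign opposite to that for vectors.\<close>

lemma ricci_identity_covec:
  assumes S: "open S" "p \<in> S" and \<Gamma>: "\<And>c a b. smooth_on S (\<Gamma> c a b)"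
    and sym: "\<And>c a b. \<Gamma> c a b p = \<Gamma> c b a p" and u: "\<And>c. smooth_on S (u c)"
  shows "nabla_cov2 \<Gamma> (nabla_covec \<Gamma> u) a b d p - nabla_cov2 \<Gamma> (nabla_covec \<Gamma> u) b a d p =
    - (\<Sum>c\<in>UNIV. curvature \<Gamma> a b c d p * u c p)"
proof -
  \<comment> \<open>Summing over the component of \<open>u\<close> last exposes the quadratic part
    of \<open>curvature_components\<close> with \<open>a\<close> and \<open>b\<close> exchanged,
    which is the source of the minus sign.\<close>
  have sw: "(\<Sum>e\<in>UNIV. \<Gamma> e a d p * (\<Sum>c\<in>UNIV. \<Gamma> c b e p * u c p)) =
     (\<Sum>c\<in>UNIV. (\<Sum>e\<in>UNIV. \<Gamma> c b e p * \<Gamma> e a d p) * u c p)" for a b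
    unfolding sum_distrib_left sum_distrib_right by (subst sum.swap) (simp only: ac_simps)
  have exp: "nabla_cov2 \<Gamma> (nabla_covec \<Gamma> u) a b d p = partial a (partial b (u d)) p
     - (\<Sum>e\<in>UNIV. \<Gamma> e b d p * partial a (u e) p) - (\<Sum>e\<in>UNIV. partial a (\<Gamma> e b d) p * u e p)
     - (\<Sum>e\<in>UNIV. \<Gamma> e a b p * nabla_covec \<Gamma> u e d p)
     - (\<Sum>e\<in>UNIV. \<Gamma> e a d p * partial b (u e) p)
     + (\<Sum>c\<in>UNIV. (\<Sum>e\<in>UNIV. \<Gamma> c b e p * \<Gamma> e a d p) * u c p)" for a b
  proof -
    have "(\<Sum>e\<in>UNIV. \<Gamma> e a d p * nabla_covec \<Gamma> u b e p) =
       (\<Sum>e\<in>UNIV. \<Gamma> e a d p * partial b (u e) p)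
     - (\<Sum>c\<in>UNIV. (\<Sum>e\<in>UNIV. \<Gamma> c b e p * \<Gamma> e a d p) * u c p)"
      unfolding nabla_covec_def right_diff_distrib sum_subtractf sw by (rule refl)
    moreover have "partial a (nabla_covec \<Gamma> u b d) p = partial a (partial b (u d)) p
     - ((\<Sum>e\<in>UNIV. \<Gamma> e b d p * partial a (u e) p) + (\<Sum>e\<in>UNIV. partial a (\<Gamma> e b d) p * u e p))"
      using partial_nabla_covec(2)[OF S \<Gamma> u] by (simp only: sum.distrib)
    ultimately show ?thesis unfolding nabla_cov2_def by simp
  qed
  have "(\<Sum>e\<in>UNIV. \<Gamma> e a b p * nabla_covec \<Gamma> u e d p) = (\<Sum>e\<in>UNIV. \<Gamma> e b a p * nabla_covec \<Gamma> u e d p)"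
    by (rule sum.cong[OF refl]) (simp only: sym[of _ a b])
  moreover have "partial a (partial b (u d)) p = partial b (partial a (u d)) p"
    by (rule partial_commute[OF u S])
  moreover have "(\<Sum>c\<in>UNIV. curvature \<Gamma> a b c d p * u c p) =
     (\<Sum>c\<in>UNIV. partial a (\<Gamma> c b d) p * u c p) - (\<Sum>c\<in>UNIV. partial b (\<Gamma> c a d) p * u c p)
     + ((\<Sum>c\<in>UNIV. (\<Sum>e\<in>UNIV. \<Gamma> c a e p * \<Gamma> e b d p) * u c p)
     - (\<Sum>c\<in>UNIV. (\<Sum>e\<in>UNIV. \<Gamma> c b e p * \<Gamma> e a d p) * u c p))"
    unfolding curvature_eq_components[where \<Gamma> = \<Gamma>, OF S \<Gamma> sym] curvature_components_def
      distrib_right left_diff_distrib sum.distrib sum_subtractf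
    by (rule refl)
  ultimately show ?thesis unfolding exp[of a b] exp[of b a] by simp
qed

section \<open>Projective change of a connection\<close>

text \<open>This formula stands in for the Levi-Civita connection throughout: its smoothness is
  inherited from \<Gamma> and \<Upsilon> rather than derived from the inverse of the metric.\<close>

definition projective_change :: "'n::finite connection \<Rightarrow> 'n tensor1 \<Rightarrow> 'n connection" where
  "projective_change \<Gamma> \<Upsilon> c a b q = \<Gamma> c a b q + kron c a * \<Upsilon> b q + kron c b * \<Upsilon> a q"

lemma smooth_on_projective_change:
  assumes S: "open S" and \<Gamma>: "\<And>c a b. smooth_on S (\<Gamma> c a b)" and \<Upsilon>: "\<And>a. smooth_on S (\<Upsilon> a)"
  shows "smooth_on S (projective_change \<Gamma> \<Upsilon> c a b)"
  unfolding projective_change_def[abs_def]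
  by (intro smooth_on_add[OF S] smooth_on_cmult[OF S] \<Gamma> \<Upsilon>)

text \<open>The hypothesis is tested on the coordinate 1-forms, whose covariant derivatives are the
  negatives of the Christoffel symbols.\<close>

lemma projectively_equivalent_viaD:
  assumes E: "projectively_equivalent_via A \<Gamma> \<Gamma>' \<Upsilon>" and \<kappa>: "\<kappa> \<in> A" and q: "q \<in> coord_range \<kappa>"
  shows "\<Gamma>' \<kappa> c a b q = projective_change (\<Gamma> \<kappa>) (\<Upsilon> \<kappa>) c a b q"
proof -
  \<comment> \<open>Here \<open>coord_vec c\<close> is read as the 1-form \<open>dx^c\<close>; its
    components are constant, so only the connection term remains.\<close>
  have nab: "nabla_covec \<Delta> (coord_vec c) a b q = - \<Delta> c a b q" for \<Delta> :: "'b connection"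
    by (simp add: nabla_covec_def coord_vec_def partial_const if_distrib[of "\<lambda>x. _ * x"] cong: if_cong)
  have "smooth_on (coord_range \<kappa>) (coord_vec c b)" for b
    by (simp add: coord_vec_def smooth_on_const)
  hence "nabla_covec (\<Gamma>' \<kappa>) (coord_vec c) a b q = nabla_covec (\<Gamma> \<kappa>) (coord_vec c) a b q
      - \<Upsilon> \<kappa> a q * coord_vec c b q - \<Upsilon> \<kappa> b q * coord_vec c a q"
    using E \<kappa> q unfolding projectively_equivalent_via_def by blast
  thus ?thesis unfolding nab by (auto simp: projective_change_def kron_def coord_vec_def)
qed

text \<open>Substitution into the component formula: partial derivatives of \<Upsilon> combine with
  the mixed products of \<Gamma> and \<Upsilon> into covariant derivatives, and everything symmetric
  in \<open>a\<close>, \<open>b\<close> drops out.\<close>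

lemma curvature_projective_change:
  assumes S: "open S" "p \<in> S" and \<Gamma>: "\<And>c a b. smooth_on S (\<Gamma> c a b)"
    and sym: "\<And>c a b. \<Gamma> c a b p = \<Gamma> c b a p" and \<Upsilon>: "\<And>a. smooth_on S (\<Upsilon> a)"
  shows "curvature (projective_change \<Gamma> \<Upsilon>) a b c d p = curvature \<Gamma> a b c d p
    + kron c d * (nabla_covec \<Gamma> \<Upsilon> a b p - nabla_covec \<Gamma> \<Upsilon> b a p)
    + kron c b * (nabla_covec \<Gamma> \<Upsilon> a d p - \<Upsilon> a p * \<Upsilon> d p)
    - kron c a * (nabla_covec \<Gamma> \<Upsilon> b d p - \<Upsilon> b p * \<Upsilon> d p)"
proof -
  let ?\<Gamma> = "projective_change \<Gamma> \<Upsilon>"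
  note [simp] = smooth_on_differentiable[OF \<Gamma> S] smooth_on_differentiable[OF \<Upsilon> S]
  have sym': "?\<Gamma> c a b p = ?\<Gamma> c b a p" for c a b
    using sym[of c a b] by (simp add: projective_change_def)
  have part: "partial a (?\<Gamma> c b d) p =
      partial a (\<Gamma> c b d) p + kron c b * partial a (\<Upsilon> d) p + kron c d * partial a (\<Upsilon> b) p" for a b c d
    unfolding projective_change_def[abs_def] by (simp add: partial_add partial_cmult)
  have quad: "(\<Sum>e\<in>UNIV. ?\<Gamma> c a e p * ?\<Gamma> e b d p) = (\<Sum>e\<in>UNIV. \<Gamma> c a e p * \<Gamma> e b d p)
      + \<Gamma> c a b p * \<Upsilon> d p + \<Gamma> c a d p * \<Upsilon> b p + \<Upsilon> a p * \<Gamma> c b d p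
      + kron c a * (\<Sum>e\<in>UNIV. \<Gamma> e b d p * \<Upsilon> e p)
      + \<Upsilon> a p * (kron c b * \<Upsilon> d p + kron c d * \<Upsilon> b p) + 2 * kron c a * \<Upsilon> b p * \<Upsilon> d p" for a b
  proof -
    \<comment> \<open>Each new summand leads with a Kronecker delta: those involving
      \<open>e\<close> are contracted by \<open>sum_kron\<close>, while \<open>kron c a\<close> is
      pulled out of the sum.\<close>
    have "?\<Gamma> c a e p * ?\<Gamma> e b d p = \<Gamma> c a e p * \<Gamma> e b d p
      + kron e b * (\<Gamma> c a e p * \<Upsilon> d p) + kron e d * (\<Gamma> c a e p * \<Upsilon> b p)
      + kron c e * (\<Upsilon> a p * \<Gamma> e b d p) + kron c a * (\<Gamma> e b d p * \<Upsilon> e p)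
      + kron c e * (\<Upsilon> a p * (kron e b * \<Upsilon> d p + kron e d * \<Upsilon> b p))
      + kron e b * (kron c a * \<Upsilon> e p * \<Upsilon> d p) + kron e d * (kron c a * \<Upsilon> e p * \<Upsilon> b p)" for e
      by (simp add: projective_change_def algebra_simps)
    thus ?thesis
      by (simp only: sum.distrib sum_kron sum_distrib_left[symmetric]) (simp add: algebra_simps)
  qed
  have "curvature ?\<Gamma> a b c d p = curvature_components ?\<Gamma> a b c d p"
    by (rule curvature_eq_components[where \<Gamma> = ?\<Gamma>, OF S
        smooth_on_projective_change[where \<Gamma> = \<Gamma> and \<Upsilon> = \<Upsilon>, OF S(1) \<Gamma> \<Upsilon>] sym'])
  moreover have "curvature \<Gamma> a b c d p = curvature_components \<Gamma> a b c d p"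
    by (rule curvature_eq_components[where \<Gamma> = \<Gamma>, OF S \<Gamma> sym])
  ultimately show ?thesis
    unfolding curvature_components_def sum_subtractf quad part nabla_covec_def
    by (simp add: sym[of _ b a] algebra_simps)
qed

text \<open>The curvature changes only by terms of the shape of the P and \<beta> parts. Absorbing
  them there leaves the Weyl part untouched, and uniqueness of the decomposition does the
  rest.\<close>

lemma projective_change_invariants:
  fixes \<Gamma> :: "'n::finite connection"
  assumes n: "CARD('n) \<ge> 2" and S: "open S" "p \<in> S" and \<Gamma>: "\<And>c a b. smooth_on S (\<Gamma> c a b)"
    and sym: "\<And>q c a b. q \<in> S \<Longrightarrow> \<Gamma> c a b q = \<Gamma> c b a q" and \<Upsilon>: "\<And>a. smooth_on S (\<Upsilon> a)"
  shows "proj_weyl (projective_change \<Gamma> \<Upsilon>) a b c d p = proj_weyl \<Gamma> a b c d p"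
    and "proj_schouten (projective_change \<Gamma> \<Upsilon>) a b p =
      proj_schouten \<Gamma> a b p - nabla_covec \<Gamma> \<Upsilon> a b p + \<Upsilon> a p * \<Upsilon> b p"
proof -
  let ?\<Gamma> = "projective_change \<Gamma> \<Upsilon>"
  have sym': "?\<Gamma> c a b q = ?\<Gamma> c b a q" if "q \<in> S" for c a b q
    using sym[OF that, of c a b] by (simp add: projective_change_def)
  obtain \<beta> where D: "projective_decomposition (\<lambda>a b c d. curvature \<Gamma> a b c d p)
      (\<lambda>a b c d. proj_weyl \<Gamma> a b c d p) (\<lambda>a b. proj_schouten \<Gamma> a b p) \<beta>"
    using projective_decomposition_curvature[where \<Gamma> = \<Gamma>, OF n S \<Gamma> sym] by blast
  obtain \<beta>' where D': "projective_decomposition (\<lambda>a b c d. curvature ?\<Gamma> a b c d p)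
      (\<lambda>a b c d. proj_weyl ?\<Gamma> a b c d p) (\<lambda>a b. proj_schouten ?\<Gamma> a b p) \<beta>'"
    using projective_decomposition_curvature[where \<Gamma> = ?\<Gamma>,
        OF n S smooth_on_projective_change[where \<Gamma> = \<Gamma> and \<Upsilon> = \<Upsilon>, OF S(1) \<Gamma> \<Upsilon>] sym'] by blast
  let ?P = "\<lambda>a b. proj_schouten \<Gamma> a b p - nabla_covec \<Gamma> \<Upsilon> a b p + \<Upsilon> a p * \<Upsilon> b p"
  \<comment> \<open>The shift of \<beta> is forced by the skew part of the new P; the product of
    \<Upsilon> with itself is symmetric and contributes nothing to it.\<close>
  have "projective_decomposition (\<lambda>a b c d. curvature ?\<Gamma> a b c d p)
      (\<lambda>a b c d. proj_weyl \<Gamma> a b c d p) ?P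
      (\<lambda>a b. \<beta> a b + nabla_covec \<Gamma> \<Upsilon> a b p - nabla_covec \<Gamma> \<Upsilon> b a p)"
    using D unfolding projective_decomposition_def
      curvature_projective_change[where \<Gamma> = \<Gamma> and \<Upsilon> = \<Upsilon>, OF S \<Gamma> sym[OF S(2)] \<Upsilon>]
    by (simp add: algebra_simps)
  from projective_decomposition_unique[OF n D' this]
  show "proj_weyl ?\<Gamma> a b c d p = proj_weyl \<Gamma> a b c d p" "proj_schouten ?\<Gamma> a b p = ?P a b"
    by (auto simp: fun_eq_iff)
qed

text \<open>Carries the Einstein condition from \<open>levi_civita\<close> to the projective change,
  which agrees with it only on the coordinate range.\<close>

lemma curvature_cong_open:
  assumes S: "open S" "p \<in> S" and eq: "\<And>q c a b. q \<in> S \<Longrightarrow> \<Gamma> c a b q = \<Gamma>' c a b q"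
  shows "curvature \<Gamma> a b c d p = curvature \<Gamma>' a b c d p"
proof -
  have v: "nabla_vec \<Gamma> v b c q = nabla_vec \<Gamma>' v b c q" if "q \<in> S" for v b c q
    using eq[OF that] by (simp add: nabla_vec_def)
  have "partial a (nabla_vec \<Gamma> v b c) p = partial a (nabla_vec \<Gamma>' v b c) p" for v a b c
    by (rule partial_cong_open[OF S v])
  thus ?thesis
    by (simp add: curvature_def nabla_mixed_def v[OF S(2)] eq[OF S(2)])
qed

section \<open>Consequences of the Einstein condition and of parallelism of the metric\<close>

text \<open>Ricci is symmetric here, so the skew term of
  \<open>projective_decomposition_explicit\<close> vanishes and the symmetric one is Ricci divided
  by \<open>n - 1\<close>.\<close>

lemma proj_schouten_einstein:
  fixes \<Gamma> :: "'n::finite connection"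
  assumes n: "CARD('n) \<ge> 2" and S: "open S" "p \<in> S" and \<Gamma>: "\<And>c a b. smooth_on S (\<Gamma> c a b)"
    and sym: "\<And>q c a b. q \<in> S \<Longrightarrow> \<Gamma> c a b q = \<Gamma> c b a q"
    and ric: "\<And>a b. ricci \<Gamma> a b p = \<mu> * g a b p" and g: "\<And>a b. g a b p = g b a p"
  shows "proj_schouten \<Gamma> a b p = \<mu> / (real CARD('n) - 1) * g a b p"
proof -
  obtain \<beta> where D: "projective_decomposition (\<lambda>a b c d. curvature \<Gamma> a b c d p)
      (\<lambda>a b c d. proj_weyl \<Gamma> a b c d p) (\<lambda>a b. proj_schouten \<Gamma> a b p) \<beta>"
    using projective_decomposition_curvature[where \<Gamma> = \<Gamma>, OF n S \<Gamma> sym] by blast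
  show ?thesis
    unfolding projective_decomposition_explicit[OF n D, of a b] ricci_def[symmetric]
    using n by (simp add: ric g[of b a] field_simps)
qed

text \<open>Expanding the parallelism of \<open>g\<close> expresses its full derivative under
  \<Gamma> through \<Upsilon> and \<open>g\<close>; in the skew part the term with factor
  \<open>\<Upsilon> d p\<close> cancels by symmetry of \<open>g\<close>.\<close>

lemma nabla_cov2_skew_projective_parallel:
  fixes \<Gamma> :: "'n::finite connection"
  assumes sym: "\<And>c a b. \<Gamma> c a b p = \<Gamma> c b a p" and g: "\<And>a b. g a b p = g b a p"
    and par: "\<And>a b d. nabla_cov2 (projective_change \<Gamma> \<Upsilon>) g a b d p = 0"
  shows "nabla_cov2 \<Gamma> g a b d p - nabla_cov2 \<Gamma> g b a d p = \<Upsilon> a p * g b d p - \<Upsilon> b p * g a d p"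
proof -
  have "nabla_cov2 \<Gamma> g a b d p =
      2 * \<Upsilon> a p * g b d p + \<Upsilon> b p * g a d p + \<Upsilon> d p * g b a p" for a b d
  proof -
    have 1: "projective_change \<Gamma> \<Upsilon> e a x p * y = \<Gamma> e a x p * y + kron e a * (\<Upsilon> x p * y)
        + kron e x * (\<Upsilon> a p * y)" for e x y
      by (simp add: projective_change_def algebra_simps)
    show ?thesis
      using par[of a b d] unfolding nabla_cov2_def
      by (simp only: 1 sum.distrib sum_kron)
  qed
  thus ?thesis by (simp add: g[of b a] algebra_simps)
qed

section \<open>The Cotton tensor and the main identity\<close>

lemma cotton_plus_weyl:
  fixes \<Gamma> :: "'n::finite connection"
  assumes n: "CARD('n) \<ge> 2" and S: "open S" "p \<in> S" and \<Gamma>: "\<And>c a b. smooth_on S (\<Gamma> c a b)"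
    and sym: "\<And>q c a b. q \<in> S \<Longrightarrow> \<Gamma> c a b q = \<Gamma> c b a q" and \<Upsilon>: "\<And>a. smooth_on S (\<Upsilon> a)"
    and gs: "\<And>a b. smooth_on S (g a b)" and g: "\<And>a b. g a b p = g b a p"
    and P: "\<And>q a b. q \<in> S \<Longrightarrow> proj_schouten (projective_change \<Gamma> \<Upsilon>) a b q = k * g a b q"
    and par: "\<And>a b d. nabla_cov2 (projective_change \<Gamma> \<Upsilon>) g a b d p = 0"
  shows "proj_cotton \<Gamma> d a b p + (\<Sum>c\<in>UNIV. proj_weyl \<Gamma> a b c d p * \<Upsilon> c p) = 0"
proof -
  let ?D = "nabla_covec \<Gamma> \<Upsilon>"
  note [simp] = smooth_on_differentiable[OF gs S] smooth_on_differentiable[OF \<Upsilon> S]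
    partial_nabla_covec(1)[where \<Gamma> = \<Gamma> and u = \<Upsilon>, OF S \<Gamma> \<Upsilon>]
  \<comment> \<open>Proved on all of \<open>S\<close>, not just at \<open>p\<close>, since it is
    differentiated next.\<close>
  have sch: "proj_schouten \<Gamma> a b q = k * g a b q + ?D a b q - \<Upsilon> a q * \<Upsilon> b q" if "q \<in> S" for a b q
    using projective_change_invariants(2)[where \<Gamma> = \<Gamma> and \<Upsilon> = \<Upsilon> and a = a and b = b,
        OF n S(1) that \<Gamma> sym \<Upsilon>] P[OF that, of a b]
    by simp
  have psch: "partial a (proj_schouten \<Gamma> b d) p = k * partial a (g b d) p + partial a (?D b d) p
      - (\<Upsilon> b p * partial a (\<Upsilon> d) p + partial a (\<Upsilon> b) p * \<Upsilon> d p)" for a b d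
  proof -
    have "partial a (proj_schouten \<Gamma> b d) p =
        partial a (\<lambda>q. k * g b d q + ?D b d q - \<Upsilon> b q * \<Upsilon> d q) p"
      by (rule partial_cong_open[OF S sch])
    thus ?thesis by (simp add: partial_diff partial_add partial_cmult partial_mult)
  qed
  \<comment> \<open>The Leibniz rule: the two correction sums of \<open>nabla_cov2\<close> turn the
    partial derivatives of the factors of the \<Upsilon> product into covariant ones.\<close>
  have nab: "nabla_cov2 \<Gamma> (proj_schouten \<Gamma>) a b d p = k * nabla_cov2 \<Gamma> g a b d p
      + nabla_cov2 \<Gamma> ?D a b d p - (?D a b p * \<Upsilon> d p + \<Upsilon> b p * ?D a d p)" for a b d
  proof -
    have 1: "x * proj_schouten \<Gamma> e d p =
        k * (x * g e d p) + x * ?D e d p - x * \<Upsilon> e p * \<Upsilon> d p" for x e d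
      by (simp add: sch[OF S(2)] algebra_simps)
    have 2: "(\<Sum>e\<in>UNIV. \<Gamma> e a d p * \<Upsilon> b p * \<Upsilon> e p) = \<Upsilon> b p * (\<Sum>e\<in>UNIV. \<Gamma> e a d p * \<Upsilon> e p)"
      by (simp add: sum_distrib_left ac_simps)
    show ?thesis
      unfolding nabla_cov2_def[of \<Gamma> "proj_schouten \<Gamma>"] 1 psch sum.distrib sum_subtractf 2
        sum_distrib_left[symmetric] sum_distrib_right[symmetric]
      unfolding nabla_cov2_def[of \<Gamma> g] nabla_cov2_def[of \<Gamma> ?D]
      unfolding nabla_covec_def[of \<Gamma> \<Upsilon> a b] nabla_covec_def[of \<Gamma> \<Upsilon> a d]
      by (simp add: algebra_simps)
  qed
  obtain \<beta> where "projective_decomposition (\<lambda>a b c d. curvature \<Gamma> a b c d p)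
      (\<lambda>a b c d. proj_weyl \<Gamma> a b c d p) (\<lambda>a b. proj_schouten \<Gamma> a b p) \<beta>"
    using projective_decomposition_curvature[where \<Gamma> = \<Gamma>, OF n S \<Gamma> sym] by blast
  hence R: "curvature \<Gamma> a b c d p = proj_weyl \<Gamma> a b c d p + kron c a * proj_schouten \<Gamma> b d p
      - kron c b * proj_schouten \<Gamma> a d p
      + kron c d * (proj_schouten \<Gamma> b a p - proj_schouten \<Gamma> a b p)" for c
    by (simp add: projective_decomposition_def)
  have "curvature \<Gamma> a b c d p * \<Upsilon> c p = proj_weyl \<Gamma> a b c d p * \<Upsilon> c p
      + kron c a * (proj_schouten \<Gamma> b d p * \<Upsilon> c p) - kron c b * (proj_schouten \<Gamma> a d p * \<Upsilon> c p)
      + kron c d * ((proj_schouten \<Gamma> b a p - proj_schouten \<Gamma> a b p) * \<Upsilon> c p)" for c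
    by (simp add: R algebra_simps)
  hence "(\<Sum>c\<in>UNIV. curvature \<Gamma> a b c d p * \<Upsilon> c p) =
      (\<Sum>c\<in>UNIV. proj_weyl \<Gamma> a b c d p * \<Upsilon> c p) + proj_schouten \<Gamma> b d p * \<Upsilon> a p
      - proj_schouten \<Gamma> a d p * \<Upsilon> b p + (proj_schouten \<Gamma> b a p - proj_schouten \<Gamma> a b p) * \<Upsilon> d p"
    by (simp only: sum.distrib sum_subtractf sum_kron)
  \<comment> \<open>On inserting \<open>sch\<close>, the terms cubic in \<Upsilon> cancel, and the
    skew part of P reduces to that of \<open>?D\<close>.\<close>
  hence RY: "(\<Sum>c\<in>UNIV. curvature \<Gamma> a b c d p * \<Upsilon> c p) =
      (\<Sum>c\<in>UNIV. proj_weyl \<Gamma> a b c d p * \<Upsilon> c p) + k * (\<Upsilon> a p * g b d p - \<Upsilon> b p * g a d p)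
      + \<Upsilon> a p * ?D b d p - \<Upsilon> b p * ?D a d p + (?D b a p - ?D a b p) * \<Upsilon> d p"
    by (simp add: sch[OF S(2)] g[of b a] algebra_simps)
  have "proj_cotton \<Gamma> d a b p = k * (nabla_cov2 \<Gamma> g a b d p - nabla_cov2 \<Gamma> g b a d p)
      + (nabla_cov2 \<Gamma> ?D a b d p - nabla_cov2 \<Gamma> ?D b a d p)
      - (?D a b p - ?D b a p) * \<Upsilon> d p - \<Upsilon> b p * ?D a d p + \<Upsilon> a p * ?D b d p"
    by (simp add: proj_cotton_def nab algebra_simps)
  \<comment> \<open>The Ricci identity contributes minus the right side of \<open>RY\<close>: its
    \<open>k\<close> terms cancel those from the derivative of \<open>g\<close>, its
    \<open>?D\<close> terms those from the Leibniz rule.\<close>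
  also have "\<dots> = - (\<Sum>c\<in>UNIV. proj_weyl \<Gamma> a b c d p * \<Upsilon> c p)"
    unfolding nabla_cov2_skew_projective_parallel[where \<Gamma> = \<Gamma> and g = g, OF sym[OF S(2)] g par]
      ricci_identity_covec[where \<Gamma> = \<Gamma> and u = \<Upsilon>, OF S \<Gamma> sym[OF S(2)] \<Upsilon>] RY
    by (simp add: algebra_simps)
  finally show ?thesis by simp
qed

theorem proposition5p1:
  fixes M :: "'a topology"
    and A :: "('a, 'n::finite) chart set"
    and \<Gamma> :: "('a, 'n) chart \<Rightarrow> 'n connection"
    and g :: "('a, 'n) chart \<Rightarrow> 'n tensor2"
    and \<Upsilon> :: "('a, 'n) chart \<Rightarrow> 'n tensor1"
  assumes "CARD('n) \<ge> 2"
    and "smooth_manifold M A"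
    and "affine_connection A \<Gamma>"
    and "torsion_free A \<Gamma>"
    and "pseudo_riemannian_metric A g"
    and "einstein A g"
    and "one_form A \<Upsilon>"
    and "projectively_equivalent_via A \<Gamma> (\<lambda>\<kappa>. levi_civita (g \<kappa>)) \<Upsilon>"
  shows "\<forall>\<kappa>\<in>A. \<forall>q\<in>coord_range \<kappa>. \<forall>i j k.
    proj_cotton (\<Gamma> \<kappa>) k i j q + (\<Sum>l\<in>UNIV. proj_weyl (\<Gamma> \<kappa>) i j l k q * \<Upsilon> \<kappa> l q) = 0"
proof (intro ballI allI)
  fix \<kappa> q i j k
  assume \<kappa>: "\<kappa> \<in> A" and q: "q \<in> coord_range \<kappa>"
  let ?S = "coord_range \<kappa>" and ?\<Gamma> = "projective_change (\<Gamma> \<kappa>) (\<Upsilon> \<kappa>)"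
  have S: "open ?S" using assms(2) \<kappa> by (auto simp: smooth_manifold_def)
  have \<Gamma>: "smooth_on ?S (\<Gamma> \<kappa> c a b)" for c a b
    using assms(3) \<kappa> by (auto simp: affine_connection_def)
  have sym: "\<Gamma> \<kappa> c a b q = \<Gamma> \<kappa> c b a q" if "q \<in> ?S" for q c a b
    using assms(4) \<kappa> that unfolding torsion_free_def by blast
  have g: "smooth_on ?S (g \<kappa> a b)" for a b
    using assms(5) \<kappa> by (auto simp: pseudo_riemannian_metric_def)
  have gsym: "g \<kappa> a b q = g \<kappa> b a q" and ginv: "invertible (\<chi> a b. g \<kappa> a b q)"
    if "q \<in> ?S" for a b q
    using assms(5) \<kappa> that unfolding pseudo_riemannian_metric_def by blast+
  have \<Upsilon>: "smooth_on ?S (\<Upsilon> \<kappa> a)" for a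
    using assms(7) \<kappa> by (auto simp: one_form_def)
  obtain \<mu> where \<mu>: "\<And>q a b. q \<in> ?S \<Longrightarrow> ricci (levi_civita (g \<kappa>)) a b q = \<mu> * g \<kappa> a b q"
    using assms(6) \<kappa> unfolding einstein_def by blast
  \<comment> \<open>From here on \<open>?\<Gamma>\<close> replaces the Levi-Civita connection on the
    chart.\<close>
  have lc: "levi_civita (g \<kappa>) c a b q = ?\<Gamma> c a b q" if "q \<in> ?S" for q c a b
    using projectively_equivalent_viaD[OF assms(8) \<kappa> that] .
  have ric: "ricci ?\<Gamma> a b q = \<mu> * g \<kappa> a b q" if "q \<in> ?S" for q a b
    using \<mu>[OF that, of a b] curvature_cong_open[where \<Gamma> = "levi_civita (g \<kappa>)", OF S that lc]
    by (simp add: ricci_def)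
  have sym': "?\<Gamma> c a b q = ?\<Gamma> c b a q" if "q \<in> ?S" for q c a b
    using sym[OF that, of c a b] by (simp add: projective_change_def)
  have smooth: "smooth_on ?S (?\<Gamma> c a b)" for c a b
    by (rule smooth_on_projective_change[where \<Gamma> = "\<Gamma> \<kappa>" and \<Upsilon> = "\<Upsilon> \<kappa>", OF S \<Gamma> \<Upsilon>])
  have P: "proj_schouten ?\<Gamma> a b q = \<mu> / (real CARD('n) - 1) * g \<kappa> a b q" if "q \<in> ?S" for q a b
    by (rule proj_schouten_einstein[where g = "g \<kappa>" and \<Gamma> = ?\<Gamma>, OF assms(1) S that
          smooth sym' ric[OF that] gsym[OF that]])
  \<comment> \<open>The characterization is read from right to left: having the Levi-Civita
    coefficients at \<open>q\<close>, \<open>?\<Gamma>\<close> makes \<open>g\<close> parallel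
    there.\<close>
  have par: "nabla_cov2 ?\<Gamma> (g \<kappa>) a b d q = 0" for a b d
    using levi_civita_characterization[where g = "g \<kappa>" and \<Gamma> = ?\<Gamma>, OF S q gsym ginv[OF q]] lc[OF q]
    by simp
  show "proj_cotton (\<Gamma> \<kappa>) k i j q + (\<Sum>l\<in>UNIV. proj_weyl (\<Gamma> \<kappa>) i j l k q * \<Upsilon> \<kappa> l q) = 0"
    by (rule cotton_plus_weyl[where g = "g \<kappa>" and \<Gamma> = "\<Gamma> \<kappa>" and \<Upsilon> = "\<Upsilon> \<kappa>", OF assms(1) S q \<Gamma> sym \<Upsilon> g gsym[OF q] P par])
qed

end
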